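(* Let $\Gamma\subset\mathbb R^2$ be a simple rectifiable oriented curve from $x_1$ to $x_2$, such that the oriented segment $[x_1,x_2]$ has outer normal $\nu_i\in\mathcal N_\phi$. Then $$P_\phi(\Gamma)-P_\phi([x_1,x_2])\ge|p_i-p_{i-1}|\,h,\qquad\text{where } h:=\sup_{z\in\Gamma}|\nu_i\cdot(z-x_1)|.$$
   Context: $\phi(\nu)=\max_{1\le i\le N}\nu\cdot p_i$ is a crystalline anisotropy on $\mathbb R^2$ (positive for $\nu\neq0$, not necessarily even), where $p_1,\dots,p_N$ (counterclockwise, indices mod $N$) are the vertices of the Wulff shape $W_\phi=\{\phi^\circ<1\}$, $\phi^\circ(x)=\sup\{x\cdot\nu:\phi(\nu)\le1\}$. $W_\phi$ is a convex polygon with facets $[p_{i-1},p_i]$; $\nu_i$ is the unit outer normal to $[p_{i-1},p_i]$ and $\mathcal N_\phi=\{\nu_i\}$. Standing assumption: adjacent vectors in $\mathcal N_\phi$ differ in angle by less than 90 degrees. An oriented rectifiable curve $\Gamma$ with arclength parametrization $\gamma$ has outer normal $\nu_\Gamma(\gamma(t))=R\gamma'(t)$, $R$ being counterclockwise rotation by 90 degrees, and $P_\phi(\Gamma)=\int_\Gamma\phi(\nu_\Gamma)\,d\mathcal H^1$. $[x,y]$ denotes the oriented segment from $x$ to $y$. *)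

theory Defs
  imports "HOL-Analysis.Analysis"
begin

subsection \<open>Crystalline anisotropies\<close>

definition anisotropy :: "nat \<Rightarrow> (nat \<Rightarrow> real^2) \<Rightarrow> real^2 \<Rightarrow> real" where
  "anisotropy N p v = Max ((\<lambda>i. v \<bullet> p i) ` {1..N})"

definition polar_anisotropy :: "(real^2 \<Rightarrow> real) \<Rightarrow> real^2 \<Rightarrow> real" where
  "polar_anisotropy \<phi> x = Sup {x \<bullet> v | v. \<phi> v \<le> 1}"

definition wulff_shape :: "(real^2 \<Rightarrow> real) \<Rightarrow> (real^2) set" where
  "wulff_shape \<phi> = {x. polar_anisotropy \<phi> x < 1}"

text \<open>
  The points p 1, ..., p N are, without repetition and in counterclockwise order, the vertices
  of the convex polygon S, and the edges of S are the segments joining consecutive vertices;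
  p 0 stands for p N. The order is expressed by polar angles about the origin, so it is
  counterclockwise order along the boundary only when 0 lies in the interior of S. This is the
  case for the closure of the Wulff shape of a positive anisotropy.
\<close>

definition ccw_polygon :: "nat \<Rightarrow> (nat \<Rightarrow> real^2) \<Rightarrow> (real^2) set \<Rightarrow> bool" where
  "ccw_polygon N p S \<longleftrightarrow>
     polytope S \<and> inj_on p {1..N} \<and>
     {x. x extreme_point_of S} = p ` {1..N} \<and>
     {F. F facet_of S} = (\<lambda>i. closed_segment (p (i - 1)) (p i)) ` {1..N} \<and>
     (\<exists>r \<theta>. (\<forall>i\<in>{1..N}. 0 < r i \<and> p i = vector [r i * cos (\<theta> i), r i * sin (\<theta> i)]) \<and>
            strict_mono_on {1..N} \<theta> \<and> \<theta> N < \<theta> 1 + (2 * pi :: real))"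

text \<open>
  For a face F of the closure of S, the inequality says that n is constant on F and attains its
  maximum over S there, so that n points out of S and is orthogonal to F.
\<close>

definition unit_outer_normal :: "(real^2) set \<Rightarrow> (real^2) set \<Rightarrow> real^2 \<Rightarrow> bool" where
  "unit_outer_normal S F n \<longleftrightarrow> norm n = 1 \<and> (\<forall>x\<in>F. \<forall>y\<in>S. n \<bullet> y \<le> n \<bullet> x)"

definition angle_between :: "real^2 \<Rightarrow> real^2 \<Rightarrow> real" where
  "angle_between u v = arccos (u \<bullet> v / (norm u * norm v))"

subsection \<open>Rectifiable curves in arclength parametrization\<close>

definition inscribed_lengths :: "(real \<Rightarrow> real^2) \<Rightarrow> real \<Rightarrow> real \<Rightarrow> real set" where
  "inscribed_lengths \<gamma> a b =
     {\<Sum>k<n. dist (\<gamma> (t k)) (\<gamma> (t (Suc k))) | n t. mono_on {..n} t \<and> t ` {..n} \<subseteq> {a..b}}"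

text \<open>
  For every s in [0, L] the restriction of the curve to [0, s] has finite length, equal to s.
  In particular the curve is 1-Lipschitz, hence continuous.
\<close>

definition arclength_parametrization :: "(real \<Rightarrow> real^2) \<Rightarrow> real \<Rightarrow> bool" where
  "arclength_parametrization \<gamma> L \<longleftrightarrow> 0 \<le> L \<and>
     (\<forall>s\<in>{0..L}. bdd_above (inscribed_lengths \<gamma> 0 s) \<and> Sup (inscribed_lengths \<gamma> 0 s) = s)"

definition rot90 :: "real^2 \<Rightarrow> real^2" where
  "rot90 v = vector [- v$2, v$1]"

text \<open>
  This is the normal at the point with parameter t. Where the curve is not differentiable, a set
  of parameters of measure zero, the value is unspecified.
\<close>

definition curve_normal :: "(real \<Rightarrow> real^2) \<Rightarrow> real \<Rightarrow> real \<Rightarrow> real^2" where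
  "curve_normal \<gamma> L t = rot90 (vector_derivative \<gamma> (at t within {0..L}))"

text \<open>
  The integral over the curve with respect to one-dimensional Hausdorff measure. For an injective
  arclength parametrization this measure is the image of Lebesgue measure on [0, L].
\<close>

definition perimeter :: "(real^2 \<Rightarrow> real) \<Rightarrow> (real \<Rightarrow> real^2) \<Rightarrow> real \<Rightarrow> real" where
  "perimeter \<phi> \<gamma> L = integral {0..L} (\<lambda>t. \<phi> (curve_normal \<gamma> L t))"

text \<open>The arclength parametrization, on [0, dist x y], of the oriented segment from x to y.\<close>

definition segment_curve :: "real^2 \<Rightarrow> real^2 \<Rightarrow> real \<Rightarrow> real^2" where
  "segment_curve x y t = x + t *\<^sub>R sgn (y - x)"

end

theory Submission
  imports Defs
begin

text \<open>
  For v in \<open>\<real>\<^sup>2\<close> write Rv for its rotation. Since \<open>\<phi> (R\<gamma>') \<ge> R\<gamma>' \<bullet> p\<^sub>k\<close> for every k,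
  cutting the curve at a point z and integrating with one endpoint a of the i-th facet before z and
  the other endpoint b after it gives \<open>P\<^sub>\<phi> \<ge> R(z - x\<^sub>1) \<bullet> a + R(x\<^sub>2 - z) \<bullet> b
  = R(x\<^sub>2 - x\<^sub>1) \<bullet> b + R(z - x\<^sub>1) \<bullet> (a - b)\<close>. The first term is the energy of the segment, and
  the second one is \<open>\<plusminus>\<bar>p\<^sub>i - p\<^sub>i\<^sub>-\<^sub>1\<bar> (\<nu>\<^sub>i \<bullet> (z - x\<^sub>1))\<close>, because the facet is orthogonal
  to \<open>\<nu>\<^sub>i\<close>; exchanging a and b produces either sign.

  The analytic input is that a Lipschitz function is differentiable almost everywhere and is the
  integral of its derivative. With \<open>\<^bold>D\<close> the upper derivate, a Vitali covering argument gives
  \<open>\<integral> \<^bold>D f \<le> f b - f a\<close>. Applied to f and -f this yields \<open>\<integral> (\<^bold>D f + \<^bold>D (- f)) \<le> 0\<close>, while the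
  integrand is nonnegative and vanishes exactly where the upper and lower derivates agree.
\<close>

subsection \<open>Lipschitz functions of a real variable\<close>

text \<open>Remove the interval with the largest right endpoint. By disjointness all others end
  before its left endpoint \<open>s x\<close>, so the induction hypothesis, with \<open>s x\<close>
  in place of \<open>b\<close>, covers them, and monotonicity handles the stretch from
  \<open>t x\<close> to \<open>b\<close>.\<close>

lemma mono_sum_disjoint_intervals_le:
  fixes f :: "real \<Rightarrow> real" and s t :: "'a \<Rightarrow> real"
  assumes "mono f" "finite F"
    and "\<And>i. i \<in> F \<Longrightarrow> a \<le> s i \<and> s i \<le> t i \<and> t i \<le> b"
    and "pairwise (\<lambda>i j. disjnt {s i..t i} {s j..t j}) F" "a \<le> b"
  shows "(\<Sum>i\<in>F. f (t i) - f (s i)) \<le> f b - f a"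
  using assms(2-)
proof (induction F arbitrary: b rule: finite_ranking_induct[where f = t])
  case empty
  then show ?case using monoD[OF \<open>mono f\<close>, of a b] by simp
next
  case (insert x F)
  show ?case
  proof (cases "x \<in> F")
    case True
    then show ?thesis using insert by (simp add: insert_absorb)
  next
    case False
    have x: "a \<le> s x" "s x \<le> t x" "t x \<le> b" using insert.prems by auto
    have "t i \<le> s x" if "i \<in> F" for i
    proof (rule ccontr)
      assume "\<not> t i \<le> s x"
      then have "t i \<in> {s i..t i} \<inter> {s x..t x}"
        using insert.hyps(2)[OF that] insert.prems(1)[of i] that by auto
      then show False
        using insert.prems(2) that False by (auto simp: pairwise_insert disjnt_def)
    qed
    then have "(\<Sum>i\<in>F. f (t i) - f (s i)) \<le> f (s x) - f a"
      using insert.prems x by (intro insert.IH) (auto simp: pairwise_insert)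
    moreover have "f (t x) \<le> f b"
      using x \<open>mono f\<close> by (simp add: monoD)
    ultimately show ?thesis
      using False insert.hyps by simp
  qed
qed

text \<open>
  The intervals on which the slope of f nearly attains u form a Vitali cover; Henstock's lemma,
  applied to finitely many disjoint ones that almost exhaust the interval, compares the integral
  of u over them with the increments of f.
\<close>
lemma integral_le_increment_of_upper_derivate:
  fixes f u :: "real \<Rightarrow> real"
  assumes "mono f" "a < b" and u: "u absolutely_integrable_on {a..b}"
    and upper: "\<And>x e d. x \<in> {a<..<b} \<Longrightarrow> 0 < e \<Longrightarrow> 0 < d \<Longrightarrow>
      \<exists>s t. s < x \<and> x < t \<and> t - s < d \<and> (u x - e) * (t - s) \<le> f t - f s"
  shows "integral {a..b} u \<le> f b - f a"
proof (rule field_le_epsilon)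
  fix e0 :: real assume "0 < e0"
  \<comment> \<open>The errors are \<open>e\<close> from Henstock's lemma and
    \<open>e * (b - a)\<close> from the slopes that only nearly attain \<open>u\<close>; together
    they stay below \<open>e0\<close>.\<close>
  define e where "e = e0 / (b - a + 2)"
  have e: "0 < e" using \<open>0 < e0\<close> \<open>a < b\<close> by (simp add: e_def)
  have intu: "u integrable_on {a..b}"
    using u by (simp add: set_lebesgue_integral_eq_integral)
  then have intu': "u integrable_on cbox a b" by simp
  obtain g where "gauge g" and g: "\<And>p. p tagged_partial_division_of (cbox a b) \<Longrightarrow> g fine p \<Longrightarrow>
      (\<Sum>(x, k)\<in>p. norm (measure lborel k *\<^sub>R u x - integral k u)) < e"
    by (rule Henstock_lemma[OF intu' e]) (rule that)
  \<comment> \<open>An interval is coded by its centre and radius, the form in which the covering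
    theorem takes balls.\<close>
  define B where "B i = cball (fst i) (snd i)" for i :: "real \<times> real"
  have Beq: "B i = {fst i - snd i..fst i + snd i}" for i
    by (simp add: B_def cball_eq_atLeastAtMost)
  \<comment> \<open>The point \<open>x\<close> serves as the tag of \<open>B i\<close>; it need not
    be the centre.\<close>
  define good where "good i x \<longleftrightarrow> x \<in> B i \<and> B i \<subseteq> g x \<inter> {a<..<b} \<and>
      (u x - e) * (2 * snd i) \<le> f (fst i + snd i) - f (fst i - snd i)" for i x
  define K where "K = {i. 0 < snd i \<and> (\<exists>x. good i x)}"
  have cov: "\<exists>i. i \<in> K \<and> x \<in> cball (fst i) (snd i) \<and> snd i < d"
    if x: "x \<in> {a<..<b}" and "0 < d" for x d
  proof -
    have "open (g x \<inter> {a<..<b})" "x \<in> g x \<inter> {a<..<b}"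
      using \<open>gauge g\<close> x by (auto simp: gauge_def)
    then obtain k where k: "0 < k" "ball x k \<subseteq> g x \<inter> {a<..<b}"
      by (meson openE)
    obtain s t where st: "s < x" "x < t" "t - s < min d k" "(u x - e) * (t - s) \<le> f t - f s"
      using upper[OF x e, of "min d k"] k \<open>0 < d\<close> by auto
    define i where "i = ((s + t) / 2, (t - s) / 2)"
    have cb: "B i = {s..t}"
      by (simp add: i_def Beq field_simps)
    have "{s..t} \<subseteq> ball x k"
      using st by (auto simp: dist_real_def)
    then have "good i x"
      using st k cb by (auto simp: good_def) (auto simp: i_def field_simps)
    then show ?thesis
      using st cb by (intro exI[of _ i]) (auto simp: K_def i_def B_def)
  qed
  have pos: "\<And>i. i \<in> K \<Longrightarrow> 0 < snd i" by (auto simp: K_def)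
  obtain C where C: "countable C" "C \<subseteq> K"
      "pairwise (\<lambda>i j. disjnt (cball (fst i) (snd i)) (cball (fst j) (snd j))) C"
      "negligible ({a<..<b} - (\<Union>i\<in>C. cball (fst i) (snd i)))"
    by (rule Vitali_covering_theorem_cballs[of K snd "{a<..<b}" fst]) (use pos cov that in blast)+
  have "C \<noteq> {}"
  proof
    assume "C = {}"
    then have "negligible {a<..<b}" using C(4) by simp
    then show False using \<open>a < b\<close> by (metis box_real(1) box_ne_empty(2) greaterThanLessThan_empty_iff linorder_not_le negligible_interval(2))
  qed
  define c where "c = from_nat_into C"
  have range_c: "range c = C"
    unfolding c_def using \<open>C \<noteq> {}\<close> C(1) by (rule range_from_nat_into)
  define \<tau> where "\<tau> i = (SOME x. good i x)" for i
  have \<tau>: "good i (\<tau> i)" if "i \<in> K" for i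
    using that unfolding \<tau>_def K_def by (auto intro: someI)
  have B_sub: "B i \<subseteq> {a<..<b}" if "i \<in> C" for i
    using \<tau>[of i] C(2) that by (auto simp: good_def)
  \<comment> \<open>The bound does not depend on \<open>F\<close>, so it survives the passage from
    finite subfamilies to all of \<open>C\<close>.\<close>
  have fin_le: "integral (\<Union>i\<in>F. B i) u \<le> f b - f a + e * (b - a + 1)" if F: "finite F" "F \<subseteq> C" for F
  proof -
    have FK: "F \<subseteq> K" using F C by auto
    have disj: "pairwise (\<lambda>i j. disjnt (B i) (B j)) F"
      using C(3) F(2) by (auto simp: B_def intro: pairwise_subset)
    have intB: "u integrable_on B i" if "i \<in> F" for i
    proof -
      have "B i \<subseteq> {a..b}" using B_sub[of i] F that by force
      then show ?thesis unfolding Beq by (rule integrable_on_subinterval[OF intu])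
    qed
    define p where "p = (\<lambda>i. (\<tau> i, B i)) ` F"
    have ne: "\<tau> i \<in> B i" if "i \<in> F" for i
      using \<tau>[of i] FK that by (auto simp: good_def)
    \<comment> \<open>Each ball contains its tag and distinct balls are disjoint, so sums over
      \<open>p\<close> are sums over \<open>F\<close>.\<close>
    have inj: "inj_on (\<lambda>i. (\<tau> i, B i)) F"
    proof (rule inj_onI)
      fix i j assume "i \<in> F" "j \<in> F" "(\<tau> i, B i) = (\<tau> j, B j)"
      then show "i = j" using disj ne[of i] unfolding pairwise_def disjnt_def by blast
    qed
    have "p tagged_partial_division_of cbox a b"
      unfolding tagged_partial_division_of_def
    proof (intro conjI allI impI)
      show "finite p" using F by (simp add: p_def)
    next
      fix x k assume "(x, k) \<in> p"
      then obtain i where i: "i \<in> F" "x = \<tau> i" "k = B i" by (auto simp: p_def)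
      show "x \<in> k" using ne i by simp
      show "k \<subseteq> cbox a b" using B_sub[of i] i F by force
      show "\<exists>a b. k = cbox a b" using i Beq by auto
    next
      fix x k y l assume *: "(x, k) \<in> p \<and> (y, l) \<in> p \<and> (x, k) \<noteq> (y, l)"
      then obtain i j where ij: "i \<in> F" "k = B i" "j \<in> F" "l = B j" "i \<noteq> j"
        by (auto simp: p_def)
      then have "B i \<inter> B j = {}" using disj by (auto simp: pairwise_def disjnt_def)
      then show "interior k \<inter> interior l = {}"
        using interior_subset ij by blast
    qed
    moreover have "g fine p"
      using \<tau> FK by (fastforce simp: fine_def p_def good_def)
    ultimately have "(\<Sum>(x, k)\<in>p. norm (measure lborel k *\<^sub>R u x - integral k u)) < e"
      by (rule g)
    then have H: "(\<Sum>i\<in>F. \<bar>measure lborel (B i) * u (\<tau> i) - integral (B i) u\<bar>) < e"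
      unfolding p_def by (subst (asm) sum.reindex[OF inj]) (simp add: o_def)
    have content_B: "measure lborel (B i) = 2 * snd i" if "i \<in> F" for i
      using FK that unfolding Beq by (auto simp: K_def)
    have increments: "(\<Sum>i\<in>F. f (fst i + snd i) - f (fst i - snd i)) \<le> f b - f a"
      and increments': "(\<Sum>i\<in>F. (fst i + snd i) - (fst i - snd i)) \<le> b - a"
    proof -
      have *: "a \<le> fst i - snd i \<and> fst i - snd i \<le> fst i + snd i \<and> fst i + snd i \<le> b"
        if "i \<in> F" for i
      proof -
        have "0 < snd i" using FK that by (auto simp: K_def)
        then have "fst i - snd i \<in> B i" "fst i + snd i \<in> B i" by (auto simp: Beq)
        then have "fst i - snd i \<in> {a<..<b}" "fst i + snd i \<in> {a<..<b}"
          using B_sub F that by blast+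
        then show ?thesis using \<open>0 < snd i\<close> by simp
      qed
      have disj': "pairwise (\<lambda>i j. disjnt {fst i - snd i..fst i + snd i} {fst j - snd j..fst j + snd j}) F"
        using disj by (simp add: Beq)
      show "(\<Sum>i\<in>F. f (fst i + snd i) - f (fst i - snd i)) \<le> f b - f a"
        by (rule mono_sum_disjoint_intervals_le[OF \<open>mono f\<close> F(1) * disj']) (use \<open>a < b\<close> in auto)
      show "(\<Sum>i\<in>F. (fst i + snd i) - (fst i - snd i)) \<le> b - a"
        by (rule mono_sum_disjoint_intervals_le[where f = "\<lambda>x. x", OF _ F(1) * disj'])
          (use \<open>a < b\<close> in \<open>auto intro: monoI\<close>)
    qed
    \<comment> \<open>Henstock's lemma bounds the integral by the tagged Riemann sum plus
      \<open>e\<close>; then \<open>good\<close> replaces each term of that sum by an increment of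
      \<open>f\<close> plus \<open>e\<close> times the length of the interval.\<close>
    have "integral (\<Union>i\<in>F. B i) u = (\<Sum>i\<in>F. integral (B i) u)"
    proof (rule integral_unique, rule has_integral_UN)
      show "pairwise (\<lambda>i i'. negligible (B i \<inter> B i')) F"
        using disj by (auto simp: pairwise_def disjnt_def)
    qed (use F intB in \<open>auto intro: integrable_integral\<close>)
    also have "\<dots> \<le> (\<Sum>i\<in>F. \<bar>measure lborel (B i) * u (\<tau> i) - integral (B i) u\<bar> + measure lborel (B i) * u (\<tau> i))"
      by (rule sum_mono) linarith
    also have "\<dots> \<le> e + (\<Sum>i\<in>F. measure lborel (B i) * u (\<tau> i))"
      using H by (simp add: sum.distrib)
    finally have le: "integral (\<Union>i\<in>F. B i) u \<le> e + (\<Sum>i\<in>F. measure lborel (B i) * u (\<tau> i))" .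
    have "(\<Sum>i\<in>F. measure lborel (B i) * u (\<tau> i)) \<le>
        (\<Sum>i\<in>F. (f (fst i + snd i) - f (fst i - snd i)) + e * ((fst i + snd i) - (fst i - snd i)))"
    proof (rule sum_mono)
      fix i assume "i \<in> F"
      then have "good i (\<tau> i)" using \<tau> FK by blast
      then show "measure lborel (B i) * u (\<tau> i) \<le>
          (f (fst i + snd i) - f (fst i - snd i)) + e * ((fst i + snd i) - (fst i - snd i))"
        using content_B[OF \<open>i \<in> F\<close>] by (auto simp: good_def algebra_simps)
    qed
    also have "\<dots> = (\<Sum>i\<in>F. f (fst i + snd i) - f (fst i - snd i))
        + e * (\<Sum>i\<in>F. (fst i + snd i) - (fst i - snd i))"
      by (simp add: sum.distrib sum_distrib_left)
    also have "\<dots> \<le> (f b - f a) + e * (b - a)"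
      by (intro add_mono mult_left_mono increments increments') (use e in simp)
    finally have "(\<Sum>i\<in>F. measure lborel (B i) * u (\<tau> i)) \<le> f b - f a + e * (b - a)" .
    with le show ?thesis using e by (simp add: algebra_simps)
  qed
  have UB: "(\<Union>k. B (c k)) = (\<Union>i\<in>C. B i)" using range_c by auto
  define A where "A n = (\<Union>k\<le>n. B (c k))" for n :: nat
  define h where "h n x = (if x \<in> A n then u x else 0)" for n x
  have A_sub: "A n \<subseteq> {a..b}" for n
  proof -
    have "B (c k) \<subseteq> {a<..<b}" for k
      using B_sub range_c by blast
    moreover have "{a<..<b} \<subseteq> {a..b}" by auto
    ultimately show ?thesis unfolding A_def by blast
  qed
  have int_h: "h n integrable_on {a..b}" for n
  proof -
    have "u absolutely_integrable_on A n"
      by (rule set_integrable_subset[OF u _ A_sub]) (auto simp: A_def B_def)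
    then have "u integrable_on (A n \<inter> {a..b})"
      using A_sub[of n] by (simp add: Int_absorb2 set_lebesgue_integral_eq_integral)
    then show ?thesis
      unfolding h_def by (simp add: integrable_restrict_Int)
  qed
  \<comment> \<open>The finite unions \<open>A n\<close> increase to the union of \<open>C\<close>,
    and the absolute value of \<open>u\<close> dominates the truncations.\<close>
  have "(\<lambda>n. integral {a..b} (h n)) \<longlonglongrightarrow>
      integral {a..b} (\<lambda>x. if x \<in> (\<Union>i\<in>C. B i) then u x else 0)"
  proof (rule dominated_convergence(2)[OF int_h])
    show "(\<lambda>x. \<bar>u x\<bar>) integrable_on {a..b}"
      using u unfolding absolutely_integrable_on_def by simp
    show "norm (h n x) \<le> \<bar>u x\<bar>" for n x by (simp add: h_def)
    show "(\<lambda>n. h n x) \<longlonglongrightarrow> (if x \<in> (\<Union>i\<in>C. B i) then u x else 0)" for x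
    proof (cases "x \<in> (\<Union>k. B (c k))")
      case True
      then obtain k where "x \<in> B (c k)" by blast
      then have "\<forall>n\<ge>k. h n x = u x" by (auto simp: h_def A_def)
      then have "(\<lambda>n. h n x) \<longlonglongrightarrow> u x"
        by (intro tendsto_eventually) (auto simp: eventually_sequentially)
      then show ?thesis using True UB by simp
    next
      case False
      then have "h n x = 0" for n by (auto simp: h_def A_def)
      then show ?thesis using False UB by simp
    qed
  qed
  moreover have "integral {a..b} (h n) \<le> f b - f a + e * (b - a + 1)" for n
  proof -
    have "integral {a..b} (h n) = integral (A n) u"
      unfolding h_def using A_sub[of n] by (simp add: integral_restrict_Int Int_absorb2)
    then show ?thesis
      using fin_le[of "c ` {..n}"] range_c by (auto simp: A_def)
  qed
  ultimately have "integral {a..b} (\<lambda>x. if x \<in> (\<Union>i\<in>C. B i) then u x else 0)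
      \<le> f b - f a + e * (b - a + 1)"
    by (meson LIMSEQ_le_const2)
  also have "integral {a..b} (\<lambda>x. if x \<in> (\<Union>i\<in>C. B i) then u x else 0) = integral {a..b} u"
  proof (rule integral_spike)
    show "negligible ({a<..<b} - (\<Union>i\<in>C. B i) \<union> {a, b})"
      using C(4) by (simp add: B_def)
  qed auto
  also have "f b - f a + e * (b - a + 1) \<le> f b - f a + e0"
    using e \<open>0 < e0\<close> \<open>a < b\<close> by (simp add: e_def field_simps)
  finally show "integral {a..b} u \<le> f b - f a + e0" .
qed

section \<open>Upper derivates of Lipschitz functions\<close>

definition slopes :: "(real \<Rightarrow> real) \<Rightarrow> real \<Rightarrow> real \<Rightarrow> real set" where
  "slopes f x d = {(f t - f s) / (t - s) | s t. s < x \<and> x < t \<and> t - s < d}"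

text \<open>
  Taking slopes over intervals around x, rather than from x, makes the suprema lower
  semicontinuous in x, hence Borel measurable.
\<close>
definition upper_derivate :: "(real \<Rightarrow> real) \<Rightarrow> real \<Rightarrow> real" where
  "upper_derivate f x = (INF n. Sup (slopes f x (1 / real (Suc n))))"

lemma slopes_nonempty:
  assumes "0 < d"
  shows "slopes f x d \<noteq> {}"
proof -
  have "(f (x + d/3) - f (x - d/3)) / ((x + d/3) - (x - d/3)) \<in> slopes f x d"
    unfolding slopes_def mem_Collect_eq
    by (intro exI[of _ "x - d/3"] exI[of _ "x + d/3"]) (use assms in auto)
  then show ?thesis by blast
qed

lemma slopes_bounded:
  assumes "K-lipschitz_on UNIV f" "q \<in> slopes f x d"
  shows "\<bar>q\<bar> \<le> K"
proof -
  obtain s t where st: "s < x" "x < t" "q = (f t - f s) / (t - s)"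
    using assms(2) by (auto simp: slopes_def)
  have "\<bar>f t - f s\<bar> \<le> K * \<bar>t - s\<bar>"
    using lipschitz_onD[OF assms(1), of t s] by (simp add: dist_real_def)
  then show ?thesis using st by (simp add: abs_divide pos_divide_le_eq)
qed

lemma bdd_above_slopes: "K-lipschitz_on UNIV f \<Longrightarrow> bdd_above (slopes f x d)"
  using slopes_bounded by (meson abs_le_D1 bdd_aboveI)

lemma Sup_slopes_bounded:
  assumes "K-lipschitz_on UNIV f" "0 < d"
  shows "\<bar>Sup (slopes f x d)\<bar> \<le> K"
  using cSup_abs_le[OF slopes_nonempty[OF assms(2)] slopes_bounded[OF assms(1)]] .

lemma bdd_below_Sup_slopes:
  assumes "K-lipschitz_on UNIV f"
  shows "bdd_below (range (\<lambda>n. Sup (slopes f x (1 / real (Suc n)))))"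
proof (rule bdd_belowI2)
  show "- K \<le> Sup (slopes f x (1 / real (Suc n)))" for n
    using Sup_slopes_bounded[OF assms, of "1 / real (Suc n)" x] by (simp add: abs_le_iff)
qed

lemma upper_derivate_bounded:
  assumes "K-lipschitz_on UNIV f"
  shows "\<bar>upper_derivate f x\<bar> \<le> K"
  unfolding upper_derivate_def
  using Sup_slopes_bounded[OF assms] by (intro cInf_abs_ge) auto

text \<open>The upper derivate is an infimum of suprema, so at every scale the supremum is at least
  as large and some slope nearly reaches it. This supplies the last hypothesis of
  \<open>integral_le_increment_of_upper_derivate\<close>.\<close>

lemma upper_derivate_less_slope:
  assumes f: "K-lipschitz_on UNIV f" and "0 < e" "0 < d"
  obtains s t where "s < x" "x < t" "t - s < d" "upper_derivate f x - e < (f t - f s) / (t - s)"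
proof -
  obtain n where n: "1 / real (Suc n) < d"
    using \<open>0 < d\<close> nat_approx_posE by blast
  have "upper_derivate f x \<le> Sup (slopes f x (1 / real (Suc n)))"
    unfolding upper_derivate_def by (rule cINF_lower[OF bdd_below_Sup_slopes[OF f]]) simp
  then have "upper_derivate f x - e < Sup (slopes f x (1 / real (Suc n)))"
    using \<open>0 < e\<close> by simp
  then obtain q where "q \<in> slopes f x (1 / real (Suc n))" "upper_derivate f x - e < q"
    using less_cSup_iff[OF slopes_nonempty bdd_above_slopes[OF f]] by (metis of_nat_0_less_iff zero_less_Suc zero_less_divide_1_iff)
  then show thesis
    using n that by (force simp: slopes_def)
qed

text \<open>Since the upper derivate is an infimum over scales, the supremum of the slopes at some
  scale is already below it plus \<open>e\<close>.\<close>

lemma slope_less_upper_derivate: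
  assumes f: "K-lipschitz_on UNIV f" and "0 < e"
  obtains d where "0 < d"
    "\<And>s t. s < x \<Longrightarrow> x < t \<Longrightarrow> t - s < d \<Longrightarrow> (f t - f s) / (t - s) < upper_derivate f x + e"
proof -
  have "upper_derivate f x < upper_derivate f x + e" using \<open>0 < e\<close> by simp
  then obtain n where n: "Sup (slopes f x (1 / real (Suc n))) < upper_derivate f x + e"
    unfolding upper_derivate_def by (subst (asm) cINF_less_iff[OF _ bdd_below_Sup_slopes[OF f]]) auto
  show thesis
  proof
    fix s t assume "s < x" "x < t" "t - s < 1 / real (Suc n)"
    then have "(f t - f s) / (t - s) \<in> slopes f x (1 / real (Suc n))"
      by (auto simp: slopes_def)
    then have "(f t - f s) / (t - s) \<le> Sup (slopes f x (1 / real (Suc n)))"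
      by (rule cSup_upper[OF _ bdd_above_slopes[OF f]])
    with n show "(f t - f s) / (t - s) < upper_derivate f x + e" by simp
  qed simp
qed

lemma borel_measurable_upper_derivate:
  assumes f: "K-lipschitz_on UNIV f"
  shows "upper_derivate f \<in> borel_measurable borel"
proof -
  have *: "(\<lambda>x. Sup (slopes f x d)) \<in> borel_measurable borel" if "0 < d" for d
    unfolding borel_measurable_iff_greater
  proof
    fix c
    have "c < Sup (slopes f x d) \<longleftrightarrow> (\<exists>q\<in>slopes f x d. c < q)" for x
      by (rule less_cSup_iff[OF slopes_nonempty[OF that] bdd_above_slopes[OF f]])
    \<comment> \<open>A slope over the interval from \<open>s\<close> to \<open>t\<close> counts for
      every point strictly between them, so each superlevel set is a union of open intervals; the
      union may be uncountable but is still open.\<close>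
    then have "{x. c < Sup (slopes f x d)} =
        (\<Union>(s, t)\<in>{(s, t). t - s < d \<and> c < (f t - f s) / (t - s)}. {s<..<t})"
      unfolding slopes_def by (auto 0 4)
    moreover have "open (\<Union>(s, t)\<in>{(s, t). t - s < d \<and> c < (f t - f s) / (t - s)}. {s<..<t})"
      by (intro open_UN) auto
    ultimately show "{w \<in> space borel. c < Sup (slopes f w d)} \<in> sets borel"
      by simp
  qed
  show ?thesis
    unfolding upper_derivate_def by (intro borel_measurable_cINF_real *) auto
qed

text \<open>On one short interval around \<open>x\<close> the slopes of \<open>f\<close> and
  \<open>-f\<close> cancel, while each lies below its own upper derivate plus
  \<open>e / 2\<close>.\<close>

lemma upper_derivate_add_upper_derivate_minus_nonneg:
  assumes f: "K-lipschitz_on UNIV f" and g: "K-lipschitz_on UNIV (\<lambda>x. - f x)"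
  shows "0 \<le> upper_derivate f x + upper_derivate (\<lambda>x. - f x) x"
proof (rule field_le_epsilon)
  fix e :: real assume "0 < e"
  obtain d1 where d1: "0 < d1" "\<And>s t. s < x \<Longrightarrow> x < t \<Longrightarrow> t - s < d1 \<Longrightarrow>
      (f t - f s) / (t - s) < upper_derivate f x + e / 2"
    using slope_less_upper_derivate[OF f, of "e / 2" x] \<open>0 < e\<close> by auto
  obtain s t where st: "s < x" "x < t" "t - s < d1"
      "upper_derivate (\<lambda>x. - f x) x - e / 2 < (- f t - - f s) / (t - s)"
    using upper_derivate_less_slope[OF g, of "e / 2" d1 x] d1 \<open>0 < e\<close> by auto
  obtain d2 where d2: "0 < d2" "\<And>s t. s < x \<Longrightarrow> x < t \<Longrightarrow> t - s < d2 \<Longrightarrow>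
      (- f t - - f s) / (t - s) < upper_derivate (\<lambda>x. - f x) x + e / 2"
    using slope_less_upper_derivate[OF g, of "e / 2" x] \<open>0 < e\<close> by auto
  \<comment> \<open>The symmetric interval around \<open>x\<close> has length \<open>2 * h\<close>,
    which is below both scales.\<close>
  define h where "h = min d1 d2 / 3"
  have h: "0 < h" "(x + h) - (x - h) < d1" "(x + h) - (x - h) < d2"
    using d1 d2 by (auto simp: h_def)
  have "(- f (x + h) - - f (x - h)) / ((x + h) - (x - h)) = - ((f (x + h) - f (x - h)) / ((x + h) - (x - h)))"
    unfolding minus_divide_left by simp
  then show "0 \<le> upper_derivate f x + upper_derivate (\<lambda>x. - f x) x + e"
    using d1(2)[OF _ _ h(2)] d2(2)[OF _ _ h(3)] h(1) by simp
qed

text \<open>The upper derivate of \<open>-f\<close> is minus the lower derivate of \<open>f\<close>,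
  so the hypothesis says that both derivates of \<open>f\<close> agree. All slopes over short
  intervals around \<open>x\<close> are then close to this common value, and continuity carries this
  over to intervals with endpoint \<open>x\<close>.\<close>

lemma has_real_derivative_upper_derivate:
  assumes f: "K-lipschitz_on UNIV f" and g: "K-lipschitz_on UNIV (\<lambda>x. - f x)"
    and eq: "upper_derivate f x + upper_derivate (\<lambda>x. - f x) x = 0"
  shows "(f has_real_derivative upper_derivate f x) (at x)"
proof -
  let ?u = "upper_derivate f x"
  have cont: "isCont f y" for y
    using lipschitz_on_continuous_on[OF f] by (simp add: continuous_on_eq_continuous_at)
  have "\<exists>d>0. \<forall>y. y \<noteq> x \<and> dist y x < d \<longrightarrow> dist ((f y - f x) / (y - x)) ?u < e" if e: "0 < e" for e
  proof -
    obtain d1 where d1: "0 < d1" "\<And>s t. s < x \<Longrightarrow> x < t \<Longrightarrow> t - s < d1 \<Longrightarrow>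
        (f t - f s) / (t - s) < ?u + e / 2"
      using slope_less_upper_derivate[OF f half_gt_zero[OF e], of x] by blast
    obtain d2 where d2: "0 < d2" "\<And>s t. s < x \<Longrightarrow> x < t \<Longrightarrow> t - s < d2 \<Longrightarrow>
        (- f t - - f s) / (t - s) < upper_derivate (\<lambda>x. - f x) x + e / 2"
      using slope_less_upper_derivate[OF g half_gt_zero[OF e], of x] by blast
    define d where "d = min d1 d2"
    have slope: "(f t - f s) / (t - s) \<in> cball ?u (e / 2)" if "s < x" "x < t" "t - s < d" for s t
    proof -
      have "(- f t - - f s) / (t - s) = - ((f t - f s) / (t - s))"
        unfolding minus_divide_left by simp
      moreover have "(f t - f s) / (t - s) < ?u + e / 2"
          "(- f t - - f s) / (t - s) < upper_derivate (\<lambda>x. - f x) x + e / 2"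
        using d1(2)[of s t] d2(2)[of s t] that by (auto simp: d_def)
      ultimately have "\<bar>?u - (f t - f s) / (t - s)\<bar> \<le> e / 2"
        using eq by linarith
      then show ?thesis by (simp add: dist_real_def)
    qed
    have slope_at: "(f y - f x) / (y - x) \<in> cball ?u (e / 2)" if "y \<noteq> x" "dist y x < d" for y
    proof (cases "x < y")
      case True
      \<comment> \<open>Let the left endpoint \<open>s\<close> increase to \<open>x\<close>. The
        estimate passes to the limit because the ball is closed.\<close>
      have "isCont (\<lambda>s. (f y - f s) / (y - s)) x"
        using True by (intro continuous_intros cont) auto
      then have lim: "((\<lambda>s. (f y - f s) / (y - s)) \<longlongrightarrow> (f y - f x) / (y - x)) (at_left x)"
        by (simp add: isCont_def filterlim_at_split)
      have "eventually (\<lambda>s. s \<in> {y - d<..<x}) (at_left x)"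
        using that True by (intro eventually_at_leftI[of "y - d"]) (auto simp: dist_real_def)
      then have "eventually (\<lambda>s. (f y - f s) / (y - s) \<in> cball ?u (e / 2)) (at_left x)"
        by eventually_elim (use True in \<open>auto intro!: slope simp del: mem_cball\<close>)
      then show ?thesis
        by (rule Lim_in_closed_set[OF closed_cball _ _ lim]) simp
    next
      case False
      then have "y < x" using that by simp
      have "isCont (\<lambda>t. (f t - f y) / (t - y)) x"
        using \<open>y < x\<close> by (intro continuous_intros cont) auto
      then have lim: "((\<lambda>t. (f t - f y) / (t - y)) \<longlongrightarrow> (f x - f y) / (x - y)) (at_right x)"
        by (simp add: isCont_def filterlim_at_split)
      have "eventually (\<lambda>t. t \<in> {x<..<y + d}) (at_right x)"
        using that \<open>y < x\<close> by (intro eventually_at_rightI[of x "y + d"]) (auto simp: dist_real_def)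
      then have "eventually (\<lambda>t. (f t - f y) / (t - y) \<in> cball ?u (e / 2)) (at_right x)"
        by eventually_elim (use \<open>y < x\<close> in \<open>auto intro!: slope simp del: mem_cball\<close>)
      then have "(f x - f y) / (x - y) \<in> cball ?u (e / 2)"
        by (rule Lim_in_closed_set[OF closed_cball _ _ lim]) simp
      moreover have "(f x - f y) / (x - y) = (f y - f x) / (y - x)"
        using \<open>y < x\<close> by (simp add: field_simps)
      ultimately show ?thesis by simp
    qed
    show ?thesis
    proof (intro exI[of _ d] conjI allI impI)
      show "0 < d" using d1 d2 by (simp add: d_def)
    next
      fix y assume "y \<noteq> x \<and> dist y x < d"
      then have "dist ((f y - f x) / (y - x)) ?u \<le> e / 2"
        using slope_at[of y] by (simp add: dist_commute)
      then show "dist ((f y - f x) / (y - x)) ?u < e" using e by simp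
    qed
  qed
  then show ?thesis
    by (simp add: has_field_derivative_iff Lim_at)
qed

section \<open>Differentiability almost everywhere and the fundamental theorem\<close>

text \<open>For a nonnegative function, extended by 0 outside \<open>S\<close>, the gauge integral
  is the Lebesgue integral, and a vanishing Lebesgue integral forces the function to vanish almost
  everywhere.\<close>

lemma negligible_nonzero_if_integral_zero:
  fixes f :: "real \<Rightarrow> real"
  assumes "\<And>x. 0 \<le> f x" "(f has_integral 0) S"
  shows "negligible {x \<in> S. f x \<noteq> 0}"
proof -
  define g where "g x = (if x \<in> S then f x else 0)" for x
  have "(g has_integral 0) UNIV"
    using assms(2) unfolding g_def by (simp add: has_integral_restrict_UNIV)
  moreover have "0 \<le> g x" for x using assms(1) by (simp add: g_def)
  ultimately have g: "g \<in> borel_measurable lebesgue" "(\<integral>\<^sup>+x. ennreal (g x) \<partial>lebesgue) = 0"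
    using has_integral_iff_nn_integral_lebesgue[of g 0] by auto
  then have "emeasure lebesgue {x \<in> space lebesgue. ennreal (g x) \<noteq> 0} = 0"
    by (subst (asm) nn_integral_0_iff) auto
  moreover have "{x \<in> space lebesgue. ennreal (g x) \<noteq> 0} \<in> sets lebesgue"
    using g(1) by measurable
  ultimately have "negligible {x \<in> space lebesgue. ennreal (g x) \<noteq> 0}"
    using negligible_iff_emeasure0 by blast
  then show ?thesis
    by (rule negligible_subset) (use assms(1) in \<open>auto simp: g_def ennreal_eq_0_iff order_antisym_conv\<close>)
qed

lemma borel_measurable_bounded_absolutely_integrable_on_interval:
  fixes f :: "real \<Rightarrow> real"
  assumes "f \<in> borel_measurable borel" "\<And>x. \<bar>f x\<bar> \<le> K"
  shows "f absolutely_integrable_on {a..b}"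
proof (rule measurable_bounded_by_integrable_imp_absolutely_integrable)
  show "f \<in> borel_measurable (lebesgue_on {a..b})"
    using assms(1) by (auto intro!: measurable_restrict_space1 measurable_completion)
  show "(\<lambda>x. K) integrable_on {a..b}"
    by (rule integrable_const_ivl)
qed (use assms in auto)

text \<open>Adding \<open>K * x\<close> makes \<open>f\<close> monotone and raises every slope by
  \<open>K\<close>, so both sides of the inequality grow by \<open>K * (b - a)\<close>.\<close>

lemma integral_upper_derivate_le:
  assumes f: "K-lipschitz_on UNIV f" and "a < b"
  shows "integral {a..b} (upper_derivate f) \<le> f b - f a"
proof -
  define g u where "g x = f x + K * x" and "u x = upper_derivate f x + K" for x
  have "0 \<le> K" using f by (rule lipschitz_on_nonneg)
  have int: "upper_derivate f integrable_on {a..b}"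
    using borel_measurable_bounded_absolutely_integrable_on_interval
      [OF borel_measurable_upper_derivate[OF f] upper_derivate_bounded[OF f]]
    by (simp add: set_lebesgue_integral_eq_integral)
  have "integral {a..b} u \<le> g b - g a"
  proof (rule integral_le_increment_of_upper_derivate[OF _ \<open>a < b\<close>])
    show "mono g"
    proof (rule monoI)
      fix x y :: real assume "x \<le> y"
      then show "g x \<le> g y"
        using lipschitz_onD[OF f, of x y] by (simp add: g_def dist_real_def abs_le_iff algebra_simps)
    qed
    show "u absolutely_integrable_on {a..b}"
    proof (rule borel_measurable_bounded_absolutely_integrable_on_interval)
      show "u \<in> borel_measurable borel"
        unfolding u_def using borel_measurable_upper_derivate[OF f] by measurable
      show "\<bar>u x\<bar> \<le> 2 * K" for x
        using upper_derivate_bounded[OF f, of x] by (auto simp: u_def)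
    qed
    fix x e d :: real assume "0 < e" "0 < d"
    then obtain s t where st: "s < x" "x < t" "t - s < d" "upper_derivate f x - e < (f t - f s) / (t - s)"
      using upper_derivate_less_slope[OF f] by metis
    then have "(upper_derivate f x - e) * (t - s) \<le> f t - f s"
      by (simp add: pos_less_divide_eq less_imp_le)
    then have "(u x - e) * (t - s) \<le> g t - g s"
      by (simp add: u_def g_def algebra_simps)
    with st show "\<exists>s t. s < x \<and> x < t \<and> t - s < d \<and> (u x - e) * (t - s) \<le> g t - g s"
      by blast
  qed
  moreover have "integral {a..b} u = integral {a..b} (upper_derivate f) + K * (b - a)"
    unfolding u_def using int \<open>a < b\<close> by (subst integral_add) auto
  ultimately show ?thesis
    by (simp add: g_def algebra_simps)
qed

lemma lipschitz_real_ftc: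
  fixes f :: "real \<Rightarrow> real"
  assumes f: "K-lipschitz_on UNIV f"
  shows lipschitz_real_differentiable_ae:
      "negligible {x. \<not> (f has_real_derivative upper_derivate f x) (at x)}"
    and has_integral_upper_derivate:
      "\<And>a b. a \<le> b \<Longrightarrow> (upper_derivate f has_integral (f b - f a)) {a..b}"
proof -
  have g: "K-lipschitz_on UNIV (\<lambda>x. - f x)"
    using f by (simp add: lipschitz_on_def dist_real_def abs_minus_commute)
  define w where "w x = upper_derivate f x + upper_derivate (\<lambda>x. - f x) x" for x
  have nonneg: "0 \<le> w x" for x
    unfolding w_def using f g by (rule upper_derivate_add_upper_derivate_minus_nonneg)
  have int: "upper_derivate h integrable_on {a..b}" if "K-lipschitz_on UNIV h" for h a b
    using borel_measurable_bounded_absolutely_integrable_on_interval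
      [OF borel_measurable_upper_derivate[OF that] upper_derivate_bounded[OF that]]
    by (simp add: set_lebesgue_integral_eq_integral)
  have w_int: "w integrable_on {a..b}" for a b
    unfolding w_def using int[OF f] int[OF g] by (rule integrable_add)
  have integral_w: "integral {a..b} w =
      integral {a..b} (upper_derivate f) + integral {a..b} (upper_derivate (\<lambda>x. - f x))" for a b
    unfolding w_def using int[OF f] int[OF g] by (rule integral_add)
  \<comment> \<open>The bounds \<open>f b - f a\<close> and \<open>f a - f b\<close> for the two
    integrals add up to 0, but \<open>w\<close> is nonnegative; hence both bounds are
    equalities.\<close>
  have w_0: "integral {a..b} w = 0" and u_eq: "integral {a..b} (upper_derivate f) = f b - f a"
    if "a < b" for a b
    using integral_upper_derivate_le[OF f that] integral_upper_derivate_le[OF g that]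
      integral_w[of a b] integral_nonneg[OF w_int[of a b]] nonneg by auto
  have "negligible ({x. w x \<noteq> 0} \<inter> cbox a b)" for a b
  proof (cases "a < b")
    case True
    have "(w has_integral 0) {a..b}"
      using w_int[of a b] w_0[OF True] by (metis integrable_integral)
    then have "negligible {x \<in> {a..b}. w x \<noteq> 0}"
      by (rule negligible_nonzero_if_integral_zero[OF nonneg])
    then show ?thesis by (rule negligible_subset) auto
  next
    case False
    then have "cbox a b \<subseteq> {a}" by auto
    then show ?thesis by (meson le_infI2 negligible_sing negligible_subset)
  qed
  then have "negligible {x. w x \<noteq> 0}"
    using negligible_on_intervals by blast
  then show "negligible {x. \<not> (f has_real_derivative upper_derivate f x) (at x)}"
    by (rule negligible_subset) (use has_real_derivative_upper_derivate[OF f g] in \<open>auto simp: w_def\<close>)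
  fix a b :: real assume "a \<le> b"
  then show "(upper_derivate f has_integral (f b - f a)) {a..b}"
  proof (cases "a = b")
    case False
    then show ?thesis
      using \<open>a \<le> b\<close> int[OF f, of a b] u_eq[of a b] by (metis integrable_integral order_less_le)
  qed (simp add: has_integral_refl)
qed

subsection \<open>Anisotropic perimeter\<close>

text \<open>A polygon inscribed in the curve up to \<open>x\<close>, prolonged by the chord from
  parameter \<open>x\<close> to parameter \<open>y\<close>, is inscribed up to \<open>y\<close>.
  Taking suprema shows that \<open>x\<close> plus the chord length is at most
  \<open>y\<close>.\<close>

lemma arclength_parametrization_lipschitz:
  assumes "arclength_parametrization \<gamma> L"
  shows "1-lipschitz_on {0..L} \<gamma>"
proof (rule lipschitz_on_leI)
  fix x y assume xy: "x \<in> {0..L}" "y \<in> {0..L}" "x \<le> y"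
  have bdd: "bdd_above (inscribed_lengths \<gamma> 0 y)"
    and Sup_x: "Sup (inscribed_lengths \<gamma> 0 x) = x" and Sup_y: "Sup (inscribed_lengths \<gamma> 0 y) = y"
    using assms xy by (auto simp: arclength_parametrization_def)
  have ne: "inscribed_lengths \<gamma> 0 x \<noteq> {}"
  proof -
    have "(\<Sum>k<0. dist (\<gamma> ((\<lambda>_. 0) k)) (\<gamma> ((\<lambda>_. 0) (Suc k)))) \<in> inscribed_lengths \<gamma> 0 x"
      unfolding inscribed_lengths_def mem_Collect_eq using xy
      by (intro exI[of _ "0::nat"] exI[of _ "\<lambda>_::nat. 0::real"]) (auto simp: mono_on_def)
    then show ?thesis by blast
  qed
  have "l \<le> y - dist (\<gamma> x) (\<gamma> y)" if "l \<in> inscribed_lengths \<gamma> 0 x" for l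
  proof -
    obtain n t where l: "l = (\<Sum>k<n. dist (\<gamma> (t k)) (\<gamma> (t (Suc k))))"
      and t: "mono_on {..n} t" "t ` {..n} \<subseteq> {0..x}"
      using \<open>l \<in> _\<close> by (auto simp: inscribed_lengths_def)
    \<comment> \<open>Two nodes are appended, \<open>x\<close> at index \<open>Suc n\<close> and
      \<open>y\<close> at index \<open>Suc (Suc n)\<close>. The edge from the old last node to
      \<open>x\<close> only adds length and is dropped at the end.\<close>
    define t' where "t' k = (if k \<le> n then t k else if k = Suc n then x else y)" for k
    have "t k \<le> x \<and> t k \<le> y" if "k \<le> n" for k
      using t(2) xy(3) that by force
    then have "mono_on {..Suc (Suc n)} t'"
      using t(1) xy by (auto simp: mono_on_def t'_def)
    moreover have "t' ` {..Suc (Suc n)} \<subseteq> {0..y}"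
      using t(2) xy by (fastforce simp: t'_def image_subset_iff)
    ultimately have "(\<Sum>k<Suc (Suc n). dist (\<gamma> (t' k)) (\<gamma> (t' (Suc k)))) \<in> inscribed_lengths \<gamma> 0 y"
      unfolding inscribed_lengths_def by blast
    then have "(\<Sum>k<Suc (Suc n). dist (\<gamma> (t' k)) (\<gamma> (t' (Suc k)))) \<le> y"
      using cSup_upper[OF _ bdd] Sup_y by simp
    moreover have "(\<Sum>k<n. dist (\<gamma> (t' k)) (\<gamma> (t' (Suc k)))) = l"
      unfolding l by (intro sum.cong) (auto simp: t'_def)
    moreover have "t' (Suc n) = x" "t' (Suc (Suc n)) = y"
      by (simp_all add: t'_def)
    ultimately have "l + dist (\<gamma> (t' n)) (\<gamma> x) + dist (\<gamma> x) (\<gamma> y) \<le> y"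
      by simp
    then show ?thesis
      using zero_le_dist[of "\<gamma> (t' n)" "\<gamma> x"] by linarith
  qed
  then have "Sup (inscribed_lengths \<gamma> 0 x) \<le> y - dist (\<gamma> x) (\<gamma> y)"
    using ne by (intro cSup_least)
  then show "dist (\<gamma> x) (\<gamma> y) \<le> 1 * dist x y"
    using Sup_x xy by (simp add: dist_real_def)
qed simp

text \<open>The right-hand side is the determinant with columns \<open>v\<close> and
  \<open>q\<close>.\<close>

lemma rot90_inner: "rot90 v \<bullet> q = v $ 1 * q $ 2 - v $ 2 * q $ 1"
  by (simp add: rot90_def inner_vec_def sum_2)

text \<open>On each side of the cut the maximum in the anisotropy is bounded below by the term of
  one fixed vertex. That term is linear in the derivative, so its integral depends only on the
  endpoints of the piece.\<close>

lemma perimeter_anisotropy_ge_two_pieces: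
  assumes lip: "1-lipschitz_on {0..L} \<gamma>" and s: "s \<in> {0..L}" and jk: "j \<in> {1..N}" "k \<in> {1..N}"
  shows "rot90 (\<gamma> s - \<gamma> 0) \<bullet> p j + rot90 (\<gamma> L - \<gamma> s) \<bullet> p k \<le> perimeter (anisotropy N p) \<gamma> L"
proof -
  \<comment> \<open>Clamping the parameter to the interval from 0 to \<open>L\<close> extends each
    coordinate to a Lipschitz function on the whole line.\<close>
  define g where "g c x = \<gamma> (max 0 (min L x)) $ c" for c x
  have g_lip: "1-lipschitz_on UNIV (g c)" for c
  proof (rule lipschitz_onI)
    fix x y :: real
    have "dist (g c x) (g c y) \<le> dist (\<gamma> (max 0 (min L x))) (\<gamma> (max 0 (min L y)))"
      unfolding g_def by (rule dist_vec_nth_le)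
    also have "\<dots> \<le> 1 * dist (max 0 (min L x)) (max 0 (min L y))"
      using s by (intro lipschitz_onD[OF lip]) auto
    also have "\<dots> \<le> 1 * dist x y"
      by (auto simp: dist_real_def)
    finally show "dist (g c x) (g c y) \<le> 1 * dist x y" .
  qed simp
  define u where "u c = upper_derivate (g c)" for c
  define D :: "real \<Rightarrow> real^2" where "D x = u 1 x *\<^sub>R axis 1 1 + u 2 x *\<^sub>R axis 2 1" for x
  have D_nth: "D x $ 1 = u 1 x" "D x $ 2 = u 2 x" for x
    by (simp_all add: D_def axis_def)
  \<comment> \<open>The endpoints are included so that near every remaining point of the interval
    the curve agrees with its extension.\<close>
  define Z where "Z = (\<Union>c. {x. \<not> (g c has_real_derivative u c x) (at x)}) \<union> {0, L}"
  have "negligible Z"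
    unfolding Z_def u_def
    by (intro negligible_Un negligible_Union[of "range _"]) (auto intro: lipschitz_real_differentiable_ae[OF g_lip])
  have normal: "curve_normal \<gamma> L x = rot90 (D x)" if x: "x \<in> {0..L} - Z" for x
  proof -
    have "((\<lambda>x. g 1 x *\<^sub>R axis 1 1 + g 2 x *\<^sub>R axis 2 1 :: real^2) has_vector_derivative D x) (at x)"
      using x unfolding D_def Z_def
      by (auto intro!: derivative_eq_intros)
    then have "(\<gamma> has_vector_derivative D x) (at x)"
    proof (rule has_vector_derivative_transform_within_open)
      show "g 1 y *\<^sub>R axis 1 1 + g 2 y *\<^sub>R axis 2 1 = \<gamma> y" if "y \<in> {0<..<L}" for y
        using that by (simp add: vec_eq_iff forall_2 g_def axis_def)
    qed (use x in \<open>auto simp: Z_def\<close>)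
    then have "(\<gamma> has_vector_derivative D x) (at x within cbox 0 L)"
      by (rule has_vector_derivative_at_within)
    then have "vector_derivative \<gamma> (at x within cbox 0 L) = D x"
      using x by (intro vector_derivative_within_cbox) (auto simp: Z_def)
    then show ?thesis by (simp add: curve_normal_def)
  qed
  have int_D: "((\<lambda>x. rot90 (D x) \<bullet> q) has_integral rot90 (\<gamma> b - \<gamma> a) \<bullet> q) {a..b}"
    if "0 \<le> a" "a \<le> b" "b \<le> L" for a b q
  proof -
    have "(u c has_integral (g c b - g c a)) {a..b}" for c
      unfolding u_def using has_integral_upper_derivate[OF g_lip \<open>a \<le> b\<close>] .
    from has_integral_diff[OF has_integral_mult_left[OF this, of 1 "q $ 2"] has_integral_mult_left[OF this, of 2 "q $ 1"]]
    show ?thesis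
      using that by (simp add: rot90_inner D_nth g_def)
  qed
  \<comment> \<open>Unlike the integrand of \<open>perimeter\<close>, \<Psi> is defined through the
    upper derivates at every point; it is Borel and bounded, hence integrable, and it differs from
    that integrand only on \<open>Z\<close>.\<close>
  define \<Psi> where "\<Psi> x = anisotropy N p (rot90 (D x))" for x
  have [measurable]: "u c \<in> borel_measurable borel" for c
    unfolding u_def by (rule borel_measurable_upper_derivate[OF g_lip])
  have \<Psi>_meas: "\<Psi> \<in> borel_measurable borel"
    unfolding \<Psi>_def anisotropy_def rot90_inner D_nth by (intro borel_measurable_Max) auto
  define K where "K = (\<Sum>m\<in>{1..N}. \<bar>p m $ 1\<bar> + \<bar>p m $ 2\<bar>)"
  have "\<bar>\<Psi> x\<bar> \<le> K" for x
  proof -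
    have "\<Psi> x \<in> (\<lambda>m. rot90 (D x) \<bullet> p m) ` {1..N}"
      unfolding \<Psi>_def anisotropy_def using jk by (intro Max_in) auto
    then obtain m where m: "m \<in> {1..N}" "\<Psi> x = u 1 x * p m $ 2 - u 2 x * p m $ 1"
      by (auto simp: rot90_inner D_nth)
    have u: "\<bar>u c x\<bar> \<le> 1" for c
      unfolding u_def by (rule upper_derivate_bounded[OF g_lip])
    have "\<bar>\<Psi> x\<bar> \<le> \<bar>u 1 x\<bar> * \<bar>p m $ 2\<bar> + \<bar>u 2 x\<bar> * \<bar>p m $ 1\<bar>"
      unfolding m abs_mult[symmetric] by (rule abs_triangle_ineq4)
    also have "\<dots> \<le> 1 * \<bar>p m $ 2\<bar> + 1 * \<bar>p m $ 1\<bar>"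
      by (intro add_mono mult_right_mono u) auto
    also have "\<dots> \<le> K"
      unfolding K_def using m(1) member_le_sum[of m "{1..N}" "\<lambda>m. \<bar>p m $ 1\<bar> + \<bar>p m $ 2\<bar>"] by simp
    finally show ?thesis .
  qed
  then have \<Psi>_int: "\<Psi> integrable_on {a..b}" for a b
    using borel_measurable_bounded_absolutely_integrable_on_interval[OF \<Psi>_meas]
      set_lebesgue_integral_eq_integral(1) by blast
  have \<Psi>_ge: "rot90 (\<gamma> b - \<gamma> a) \<bullet> p m \<le> integral {a..b} \<Psi>"
    if "0 \<le> a" "a \<le> b" "b \<le> L" "m \<in> {1..N}" for a b m
  proof (rule has_integral_le[OF int_D[OF that(1-3)] integrable_integral[OF \<Psi>_int]])
    show "rot90 (D x) \<bullet> p m \<le> \<Psi> x" for x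
      unfolding \<Psi>_def anisotropy_def using that(4) by (intro Max_ge) auto
  qed
  have "perimeter (anisotropy N p) \<gamma> L = integral {0..L} \<Psi>"
    unfolding perimeter_def \<Psi>_def
    by (rule integral_spike[OF \<open>negligible Z\<close>]) (simp add: normal)
  also have "\<dots> = integral {0..s} \<Psi> + integral {s..L} \<Psi>"
    using s by (intro Henstock_Kurzweil_Integration.integral_combine[symmetric] \<Psi>_int) auto
  finally show ?thesis
    using \<Psi>_ge[of 0 s j] \<Psi>_ge[of s L k] s jk by simp
qed

section \<open>The segment, the facet and the final estimate\<close>

lemma vector_derivative_segment_curve:
  assumes "t \<in> {0..dist x y}" "x \<noteq> y"
  shows "vector_derivative (segment_curve x y) (at t within {0..dist x y}) = sgn (y - x)"
proof -
  have "(segment_curve x y has_vector_derivative sgn (y - x)) (at t within cbox 0 (dist x y))"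
    unfolding segment_curve_def by (auto intro!: derivative_eq_intros)
  then have "vector_derivative (segment_curve x y) (at t within cbox 0 (dist x y)) = sgn (y - x)"
    using assms by (intro vector_derivative_within_cbox) auto
  then show ?thesis by simp
qed

text \<open>In the plane a vector orthogonal to the unit vector \<open>n\<close> is a multiple
  \<open>c\<close> of \<open>rot90 n\<close>, and rotation preserves inner products.\<close>

lemma abs_rot90_inner_of_orthogonal:
  assumes "norm n = 1" "n \<bullet> v = 0"
  shows "\<bar>rot90 w \<bullet> v\<bar> = norm v * \<bar>n \<bullet> w\<bar>"
proof -
  \<comment> \<open>This is \<open>rot90 n \<bullet> v\<close>, the coordinate of \<open>v\<close>
    along \<open>rot90 n\<close>.\<close>
  define c where "c = n $ 1 * v $ 2 - n $ 2 * v $ 1"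
  have n: "n $ 1 * n $ 1 + n $ 2 * n $ 2 = 1"
    using assms(1) by (simp add: norm_eq_1 inner_vec_def sum_2)
  have v: "n $ 1 * v $ 1 + n $ 2 * v $ 2 = 0"
    using assms(2) by (simp add: inner_vec_def sum_2)
  have v_eq: "v $ 1 = - c * n $ 2" "v $ 2 = c * n $ 1"
    using n v unfolding c_def by algebra+
  have "norm v = sqrt (c\<^sup>2 * (n $ 1 * n $ 1 + n $ 2 * n $ 2))"
    by (simp add: norm_eq_sqrt_inner inner_vec_def sum_2 v_eq power2_eq_square algebra_simps)
  then have "norm v = \<bar>c\<bar>" using n by simp
  moreover have "rot90 w \<bullet> v = c * (n \<bullet> w)"
    unfolding rot90_inner by (simp add: v_eq inner_vec_def sum_2 algebra_simps)
  ultimately show ?thesis by (simp add: abs_mult)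
qed

theorem proposition3p9:
  fixes N i :: nat
    and p \<nu> :: "nat \<Rightarrow> real^2"
    and \<phi> :: "real^2 \<Rightarrow> real"
    and \<gamma> :: "real \<Rightarrow> real^2"
    and L :: real
    and x1 x2 :: "real^2"
  assumes "3 \<le> N"
    and "\<forall>j. p (j + N) = p j"
    and "\<forall>j. \<nu> (j + N) = \<nu> j"
    and "\<phi> = anisotropy N p"
    and "\<forall>v. v \<noteq> 0 \<longrightarrow> 0 < \<phi> v"
    and "ccw_polygon N p (closure (wulff_shape \<phi>))"
    and "\<forall>j\<in>{1..N}. unit_outer_normal (wulff_shape \<phi>) (closed_segment (p (j - 1)) (p j)) (\<nu> j)"
    and "\<forall>j\<in>{1..N}. angle_between (\<nu> j) (\<nu> (j + 1)) < pi / 2"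
    and "arclength_parametrization \<gamma> L"
    and "inj_on \<gamma> {0..L}"
    and "\<gamma> 0 = x1"
    and "\<gamma> L = x2"
    and "i \<in> {1..N}"
    and "x1 \<noteq> x2"
    and "\<forall>t\<in>{0..dist x1 x2}. curve_normal (segment_curve x1 x2) (dist x1 x2) t = \<nu> i"
  shows "perimeter \<phi> \<gamma> L - perimeter \<phi> (segment_curve x1 x2) (dist x1 x2)
           \<ge> norm (p i - p (i - 1)) * (SUP z\<in>\<gamma> ` {0..L}. \<bar>\<nu> i \<bullet> (z - x1)\<bar>)"
proof -
  define S where "S = wulff_shape \<phi>"
  define n where "n = \<nu> i"
  define d where "d = dist x1 x2"
  have normal: "norm n = 1" "\<And>x y. x \<in> closed_segment (p (i - 1)) (p i) \<Longrightarrow> y \<in> S \<Longrightarrow> n \<bullet> y \<le> n \<bullet> x"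
    using assms(7,13) by (auto simp: unit_outer_normal_def n_def S_def)
  have "p ` {1..N} = {x. x extreme_point_of closure S}"
    using assms(6) by (simp add: ccw_polygon_def S_def)
  then have vertex: "p m \<in> closure S" if "m \<in> {1..N}" for m
    using that by (auto simp: extreme_point_of_def)
  \<comment> \<open>The normal condition speaks of \<open>S\<close>, whereas the vertices are known
    to lie in its closure; a closed half-plane containing \<open>S\<close> contains both.\<close>
  have le: "n \<bullet> p m \<le> n \<bullet> x" if "m \<in> {1..N}" "x \<in> {p (i - 1), p i}" for m x
  proof -
    have "closure S \<subseteq> {y. n \<bullet> y \<le> n \<bullet> x}"
      using normal(2) that(2) by (intro closure_minimal) (auto simp: closed_halfspace_le)
    then show ?thesis using vertex[OF that(1)] by auto
  qed
  \<comment> \<open>The index \<open>i - 1\<close> may be 0, outside the range of the maximum;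
    periodicity then replaces it by \<open>N\<close>.\<close>
  obtain i' where i': "i' \<in> {1..N}" "p (i - 1) = p i'"
  proof (cases "i = 1")
    case True
    then show thesis using that[of N] assms(1) assms(2)[rule_format, of 0] by simp
  next
    case False
    then show thesis using that[of "i - 1"] assms(13) by fastforce
  qed
  \<comment> \<open>Both ends of the facet maximize the product with \<open>n\<close> over the
    vertices, so the two values agree and equal \<open>\<phi> n\<close>.\<close>
  have eq: "n \<bullet> p i' = n \<bullet> p i"
    using le[of i' "p i"] le[of i "p i'"] i' assms(13) by auto
  have \<phi>_n: "\<phi> n = n \<bullet> p i"
    unfolding assms(4) anisotropy_def
    using le assms(13) by (intro Max_eqI) auto
  have "0 < d" using assms(14) by (simp add: d_def)
  have rot_sgn: "rot90 (sgn (x2 - x1)) = n"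
    using assms(15)[rule_format, of 0] vector_derivative_segment_curve[OF _ assms(14), of 0]
    by (simp add: curve_normal_def n_def)
  have rot: "rot90 (x2 - x1) \<bullet> q = d * (n \<bullet> q)" for q
  proof -
    have "x2 - x1 = d *\<^sub>R sgn (x2 - x1)"
      using assms(14) by (simp add: d_def sgn_div_norm dist_norm norm_minus_commute)
    then have "rot90 (x2 - x1) \<bullet> q = rot90 (d *\<^sub>R sgn (x2 - x1)) \<bullet> q" by simp
    also have "\<dots> = d * (rot90 (sgn (x2 - x1)) \<bullet> q)"
      by (simp add: rot90_inner algebra_simps)
    finally show ?thesis by (simp add: rot_sgn)
  qed
  have seg: "perimeter \<phi> (segment_curve x1 x2) d = d * \<phi> n"
  proof -
    have "perimeter \<phi> (segment_curve x1 x2) d = integral {0..d} (\<lambda>_. \<phi> n)"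
      unfolding perimeter_def using assms(15) by (intro integral_cong) (simp add: d_def n_def)
    then show ?thesis using \<open>0 < d\<close> by simp
  qed
  have "0 \<le> L" using assms(9) by (simp add: arclength_parametrization_def)
  have ge: "norm (p i - p i') * \<bar>n \<bullet> (\<gamma> s - x1)\<bar> \<le> perimeter \<phi> \<gamma> L - d * \<phi> n"
    if s: "s \<in> {0..L}" for s
  proof -
    have two: "rot90 (\<gamma> s - x1) \<bullet> p j + rot90 (x2 - \<gamma> s) \<bullet> p k \<le> perimeter \<phi> \<gamma> L"
      if "j \<in> {1..N}" "k \<in> {1..N}" for j k
      using perimeter_anisotropy_ge_two_pieces[OF arclength_parametrization_lipschitz[OF assms(9)] s that]
      by (simp add: assms(4,11,12))
    have split: "rot90 (x2 - \<gamma> s) \<bullet> q = d * (n \<bullet> q) - rot90 (\<gamma> s - x1) \<bullet> q" for q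
      unfolding rot[symmetric] by (simp add: rot90_inner algebra_simps)
    \<comment> \<open>The two orders of the facet endpoints give the two signs. By
      \<open>split\<close> and \<open>eq\<close>, each leaves the energy \<open>d * \<phi> n\<close>
      of the segment plus a product with the facet vector.\<close>
    have "\<bar>rot90 (\<gamma> s - x1) \<bullet> (p i - p i')\<bar> \<le> perimeter \<phi> \<gamma> L - d * \<phi> n"
      using two[OF assms(13) i'(1)] two[OF i'(1) assms(13)]
      by (simp add: split eq \<phi>_n inner_diff_right abs_le_iff)
    moreover have "n \<bullet> (p i - p i') = 0"
      using eq by (simp add: inner_diff_right)
    ultimately show ?thesis
      using abs_rot90_inner_of_orthogonal[OF normal(1)] by simp
  qed
  have "norm (p i - p i') * (SUP z\<in>\<gamma> ` {0..L}. \<bar>n \<bullet> (z - x1)\<bar>) \<le> perimeter \<phi> \<gamma> L - d * \<phi> n"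
  \<comment> \<open>The supremum is bounded after division by the facet length; for length 0 the
    estimate at a single parameter suffices.\<close>
  proof (cases "p i = p i'")
    case True
    then show ?thesis using ge[of 0] \<open>0 \<le> L\<close> by simp
  next
    case False
    then have "0 < norm (p i - p i')" by simp
    moreover have "(SUP z\<in>\<gamma> ` {0..L}. \<bar>n \<bullet> (z - x1)\<bar>) \<le> (perimeter \<phi> \<gamma> L - d * \<phi> n) / norm (p i - p i')"
      using \<open>0 \<le> L\<close> ge calculation
      by (intro cSUP_least) (auto simp: pos_le_divide_eq mult.commute)
    ultimately show ?thesis
      by (simp add: pos_le_divide_eq mult.commute)
  qed
  then show ?thesis
    using seg i' by (simp add: n_def d_def)
qed

end
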